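(* Let $k,\ell,n$ be positive integers with $k<\ell$. Then $$\dim(\mathcal{M}_{[k,\ell]}^n)\le 34(\ell-k)^2\log n.$$
   Context: $\log$ denotes the natural logarithm, and $[n]=\{1,\dots,n\}$. $\mathcal{M}^n$ is the (infinite) poset of all multisets of elements of $[n]$ (with finite multiplicities) ordered by inclusion: $S\subseteq T$ iff each element has multiplicity in $S$ at most its multiplicity in $T$. $\mathcal{M}^n_{[k,\ell]}$ is the suborder of $\mathcal{M}^n$ on the multisets $S$ with $k\le|S|\le\ell$, where $|S|$ counts elements with multiplicity. The Dushnik–Miller dimension $\dim(P)$ of a finite poset $P$ is the least $d\in\mathbb{N}$ such that $P$ embeds (is order-isomorphic to a suborder) into a product of $d$ chains (linear orders), where a product of posets carries the coordinatewise order.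
   Formalization: The formal theorem assumes n ≥ 2 instead of n ≥ 1: for n = 1 the poset is a chain with at least two elements, so its dimension is 1 while the bound 34(ℓ−k)² log 1 is 0. *)

theory Defs
  imports Complex_Main "HOL-Library.Multiset" "HOL-Library.FuncSet"
begin

text \<open>
  A poset is represented by its reflexive order relation \<open>r\<close>; its carrier is \<open>Field r\<close>.
\<close>

definition product_order :: "'i set \<Rightarrow> ('i \<Rightarrow> 'c rel) \<Rightarrow> ('i \<Rightarrow> 'c) rel" where
  "product_order I c =
     {(x, y). x \<in> (\<Pi>\<^sub>E i\<in>I. Field (c i)) \<and> y \<in> (\<Pi>\<^sub>E i\<in>I. Field (c i)) \<and>
              (\<forall>i\<in>I. (x i, y i) \<in> c i)}"

definition order_embedding :: "'a rel \<Rightarrow> 'b rel \<Rightarrow> ('a \<Rightarrow> 'b) \<Rightarrow> bool" where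
  "order_embedding r s f \<longleftrightarrow>
     f ` Field r \<subseteq> Field s \<and> inj_on f (Field r) \<and>
     (\<forall>x\<in>Field r. \<forall>y\<in>Field r. (x, y) \<in> r \<longleftrightarrow> (f x, f y) \<in> s)"

definition embeds_in_chains :: "'a rel \<Rightarrow> nat \<Rightarrow> (nat \<Rightarrow> 'c rel) \<Rightarrow> bool" where
  "embeds_in_chains r d c \<longleftrightarrow>
     (\<forall>i<d. Linear_order (c i)) \<and> (\<exists>f. order_embedding r (product_order {..<d} c) f)"

text \<open>
  HOL cannot quantify over the types of the chains inside a formula. In the definition of the
  dimension they live on the type of the elements of the poset, which loses nothing: the lemma
  \<open>embeds_in_chains_transfer\<close> below replaces chains over any other type. By the lemma
  \<open>embeds_in_chains_dm_dim\<close> the minimum exists for every finite poset.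
\<close>

definition dm_dim :: "'a rel \<Rightarrow> nat" where
  "dm_dim r = (LEAST d. \<exists>c :: nat \<Rightarrow> 'a rel. embeds_in_chains r d c)"

definition multiset_poset :: "nat \<Rightarrow> nat multiset rel" where
  "multiset_poset n = {(S, T). set_mset S \<subseteq> {1..n} \<and> set_mset T \<subseteq> {1..n} \<and> S \<subseteq># T}"

definition multiset_layers :: "nat \<Rightarrow> nat \<Rightarrow> nat \<Rightarrow> nat multiset rel" where
  "multiset_layers n k l = Restr (multiset_poset n) {S. k \<le> size S \<and> size S \<le> l}"

lemma Field_product_order:
  assumes "\<And>i. i \<in> I \<Longrightarrow> Refl (c i)"
  shows "Field (product_order I c) = (\<Pi>\<^sub>E i\<in>I. Field (c i))"
proof
  show "Field (product_order I c) \<subseteq> (\<Pi>\<^sub>E i\<in>I. Field (c i))"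
    by (auto simp: Field_def product_order_def)
  show "(\<Pi>\<^sub>E i\<in>I. Field (c i)) \<subseteq> Field (product_order I c)"
  proof
    fix x assume x: "x \<in> (\<Pi>\<^sub>E i\<in>I. Field (c i))"
    have "(x i, x i) \<in> c i" if "i \<in> I" for i
      using x assms[OF that] that by (meson PiE_mem refl_onD)
    with x have "(x, x) \<in> product_order I c"
      unfolding product_order_def by blast
    then show "x \<in> Field (product_order I c)" by (rule FieldI1)
  qed
qed

lemma embeds_in_chains_transfer:
  fixes r :: "'a rel" and c :: "nat \<Rightarrow> 'c rel"
  assumes "embeds_in_chains r d c"
  shows "\<exists>c' :: nat \<Rightarrow> 'a rel. embeds_in_chains r d c'"
proof -
  from assms obtain f where lin: "\<And>i. i < d \<Longrightarrow> Linear_order (c i)"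
    and f: "order_embedding r (product_order {..<d} c) f"
    unfolding embeds_in_chains_def by blast
  have refl: "Refl (c i)" if "i < d" for i
    using lin[OF that] by (simp add: order_on_defs)
  have Fld: "Field (product_order {..<d} c) = (\<Pi>\<^sub>E i\<in>{..<d}. Field (c i))"
    using refl by (intro Field_product_order) simp
  have fF: "f x \<in> (\<Pi>\<^sub>E i\<in>{..<d}. Field (c i))" if "x \<in> Field r" for x
    using f that Fld unfolding order_embedding_def by blast
  define h where "h = (\<lambda>i x. inv_into (Field r) (\<lambda>y. f y i) (f x i))"
  have h: "h i x \<in> Field r" "f (h i x) i = f x i" if "x \<in> Field r" for i x
  proof -
    have *: "f x i \<in> (\<lambda>y. f y i) ` Field r" using that by blast
    show "h i x \<in> Field r" unfolding h_def using inv_into_into[OF *] .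
    show "f (h i x) i = f x i" unfolding h_def using f_inv_into_f[OF *] .
  qed
  have heq: "h i x = h i y" if "f x i = f y i" for i x y
    using that by (simp add: h_def)
  define c' where "c' = (\<lambda>i. {(h i x, h i y) | x y. x \<in> Field r \<and> y \<in> Field r \<and> (f x i, f y i) \<in> c i})"
  have c'_iff: "(h i x, h i y) \<in> c' i \<longleftrightarrow> (f x i, f y i) \<in> c i"
    if "x \<in> Field r" "y \<in> Field r" for i x y
  proof
    assume "(h i x, h i y) \<in> c' i"
    then obtain x' y' where "x' \<in> Field r" "y' \<in> Field r" "h i x = h i x'" "h i y = h i y'"
      "(f x' i, f y' i) \<in> c i" unfolding c'_def by blast
    then show "(f x i, f y i) \<in> c i" using h(2) that by metis
  qed (use that in \<open>auto simp: c'_def\<close>)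
  have in_c': "\<exists>x y. p = (h i x, h i y) \<and> x \<in> Field r \<and> y \<in> Field r" if "p \<in> c' i" for p i
    using that unfolding c'_def by blast
  have fxx: "(f x i, f x i) \<in> c i" if "x \<in> Field r" "i < d" for x i
    using refl[OF that(2)] fF[OF that(1)] that(2) by (meson PiE_mem lessThan_iff refl_onD)
  have Fc': "Field (c' i) = h i ` Field r" if "i < d" for i
  proof
    show "Field (c' i) \<subseteq> h i ` Field r"
    proof
      fix a assume "a \<in> Field (c' i)"
      then obtain b where "(a, b) \<in> c' i \<or> (b, a) \<in> c' i" by (auto simp: Field_def)
      then show "a \<in> h i ` Field r" using in_c' by blast
    qed
    show "h i ` Field r \<subseteq> Field (c' i)"
    proof
      fix a assume "a \<in> h i ` Field r"
      then obtain x where x: "a = h i x" "x \<in> Field r" by blast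
      have "(h i x, h i x) \<in> c' i" using c'_iff[OF x(2) x(2)] fxx[OF x(2) that] by simp
      then show "a \<in> Field (c' i)" using x by (simp add: FieldI1)
    qed
  qed
  have lin': "Linear_order (c' i)" if i: "i < d" for i
  proof -
    have "trans (c i)" "antisym (c i)" "total_on (Field (c i)) (c i)"
      using lin[OF i] by (simp_all add: order_on_defs)
    have "Refl (c' i)"
      unfolding refl_on_def Fc'[OF i] using c'_iff fxx[OF _ i] by simp
    moreover have "trans (c' i)"
    proof (rule transI)
      fix a b e assume ab: "(a, b) \<in> c' i" and be: "(b, e) \<in> c' i"
      obtain x y where x: "a = h i x" "b = h i y" "x \<in> Field r" "y \<in> Field r"
        using in_c'[OF ab] by blast
      obtain z where z: "e = h i z" "z \<in> Field r"
        using in_c'[OF be] by blast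
      show "(a, e) \<in> c' i"
        using ab be c'_iff[OF x(3,4)] c'_iff[OF x(4) z(2)] c'_iff[OF x(3) z(2)]
          transD[OF \<open>trans (c i)\<close>, of "f x i" "f y i" "f z i"] x z by simp
    qed
    moreover have "antisym (c' i)"
    proof (rule antisymI)
      fix a b assume ab: "(a, b) \<in> c' i" and ba: "(b, a) \<in> c' i"
      obtain x y where x: "a = h i x" "b = h i y" "x \<in> Field r" "y \<in> Field r"
        using in_c'[OF ab] by blast
      have "(f x i, f y i) \<in> c i" "(f y i, f x i) \<in> c i"
        using ab ba x c'_iff[OF x(3,4)] c'_iff[OF x(4,3)] by simp_all
      then have "f x i = f y i" using antisymD[OF \<open>antisym (c i)\<close>] by blast
      then show "a = b" using x heq[of x i y] by simp
    qed
    moreover have "Total (c' i)"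
    proof (unfold total_on_def Fc'[OF i], intro ballI impI)
      fix a b assume "a \<in> h i ` Field r" "b \<in> h i ` Field r" "a \<noteq> b"
      then obtain x y where x: "a = h i x" "b = h i y" "x \<in> Field r" "y \<in> Field r" by blast
      with \<open>a \<noteq> b\<close> have "f x i \<noteq> f y i" using heq[of x i y] by auto
      moreover have "f x i \<in> Field (c i)" "f y i \<in> Field (c i)"
        using fF x i by (meson PiE_mem lessThan_iff)+
      ultimately have "(f x i, f y i) \<in> c i \<or> (f y i, f x i) \<in> c i"
        using \<open>total_on (Field (c i)) (c i)\<close> by (auto simp: total_on_def)
      then show "(a, b) \<in> c' i \<or> (b, a) \<in> c' i"
        using x c'_iff[OF x(3,4)] c'_iff[OF x(4,3)] by simp
    qed
    moreover have "c' i \<subseteq> Field (c' i) \<times> Field (c' i)"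
      by (auto intro: FieldI1 FieldI2)
    ultimately show ?thesis by (simp add: order_on_defs)
  qed
  define g where "g = (\<lambda>x. \<lambda>i\<in>{..<d}. h i x)"
  have Fld': "Field (product_order {..<d} c') = (\<Pi>\<^sub>E i\<in>{..<d}. Field (c' i))"
    using lin' by (intro Field_product_order) (simp add: order_on_defs)
  have gF: "g x \<in> (\<Pi>\<^sub>E i\<in>{..<d}. Field (c' i))" if "x \<in> Field r" for x
    using that by (auto simp: g_def Fc')
  have "order_embedding r (product_order {..<d} c') g"
    unfolding order_embedding_def
  proof (intro conjI ballI)
    show "g ` Field r \<subseteq> Field (product_order {..<d} c')"
      using gF Fld' by blast
    show "inj_on g (Field r)"
    proof (rule inj_onI)
      fix x y assume xy: "x \<in> Field r" "y \<in> Field r" "g x = g y"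
      have "f x i = f y i" if "i < d" for i
      proof -
        have "h i x = h i y" using fun_cong[OF xy(3), of i] that by (simp add: g_def)
        then show ?thesis using h(2)[OF xy(1), of i] h(2)[OF xy(2), of i] by simp
      qed
      then have "f x = f y"
        by (intro PiE_ext[OF fF[OF xy(1)] fF[OF xy(2)]]) simp
      then show "x = y"
        using f xy by (auto simp: order_embedding_def inj_on_def)
    qed
  next
    fix x y assume xy: "x \<in> Field r" "y \<in> Field r"
    have "(x, y) \<in> r \<longleftrightarrow> (f x, f y) \<in> product_order {..<d} c"
      using f xy by (auto simp: order_embedding_def)
    also have "\<dots> \<longleftrightarrow> (\<forall>i<d. (f x i, f y i) \<in> c i)"
      using fF[OF xy(1)] fF[OF xy(2)] unfolding product_order_def by blast
    also have "\<dots> \<longleftrightarrow> (\<forall>i<d. (g x i, g y i) \<in> c' i)"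
      using c'_iff[OF xy] by (simp add: g_def)
    also have "\<dots> \<longleftrightarrow> (g x, g y) \<in> product_order {..<d} c'"
      using gF[OF xy(1)] gF[OF xy(2)] unfolding product_order_def by blast
    finally show "(x, y) \<in> r \<longleftrightarrow> (g x, g y) \<in> product_order {..<d} c'" .
  qed
  then show ?thesis
    unfolding embeds_in_chains_def using lin' by blast
qed

corollary dm_dim_le:
  fixes c :: "nat \<Rightarrow> 'c rel"
  assumes "embeds_in_chains r d c"
  shows "dm_dim r \<le> d"
  unfolding dm_dim_def using embeds_in_chains_transfer[OF assms] by (rule Least_le)

lemma embeds_in_chains_dm_dim:
  fixes r :: "'a rel"
  assumes r: "Partial_order r" and fin: "finite (Field r)"
  shows "\<exists>c :: nat \<Rightarrow> 'a rel. embeds_in_chains r (dm_dim r) c"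
proof -
  let ?d = "card (Field r)"
  obtain e where e: "bij_betw e {..<?d} (Field r)"
    using ex_bij_betw_nat_finite[OF fin] by (auto simp: atLeast0LessThan)
  have rfl: "\<And>x. x \<in> Field r \<Longrightarrow> (x, x) \<in> r" and tr: "trans r" and asym: "antisym r"
    using r by (auto simp: order_on_defs refl_on_def)
  define c :: "nat \<Rightarrow> bool rel" where "c = (\<lambda>_. {(a, b). a \<le> b})"
  have Fc: "Field (c i) = UNIV" for i by (auto simp: c_def Field_def)
  have lin: "Linear_order (c i)" for i
    unfolding order_on_defs Fc
    by (auto simp: c_def refl_on_def trans_def antisym_def total_on_def)
  define f where "f = (\<lambda>x. \<lambda>i\<in>{..<?d}. (e i, x) \<in> r)"
  have le: "(x, y) \<in> r \<longleftrightarrow> (\<forall>i<?d. f x i \<longrightarrow> f y i)" if "x \<in> Field r" "y \<in> Field r" for x y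
  proof
    assume "(x, y) \<in> r"
    then show "\<forall>i<?d. f x i \<longrightarrow> f y i" using transD[OF tr] by (auto simp: f_def)
  next
    assume *: "\<forall>i<?d. f x i \<longrightarrow> f y i"
    have "x \<in> e ` {..<?d}" using e that(1) by (simp add: bij_betw_def)
    then obtain i where i: "i < ?d" "e i = x" by blast
    have "f x i" using rfl[OF that(1)] i by (simp add: f_def)
    with * i(1) have "f y i" by blast
    then show "(x, y) \<in> r" using i by (simp add: f_def)
  qed
  have Fld: "Field (product_order {..<?d} c) = (\<Pi>\<^sub>E i\<in>{..<?d}. UNIV)"
    using Field_product_order[of "{..<?d}" c] lin by (simp add: order_on_defs Fc)
  have fF: "f x \<in> (\<Pi>\<^sub>E i\<in>{..<?d}. UNIV)" for x by (simp add: f_def)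
  have "order_embedding r (product_order {..<?d} c) f"
    unfolding order_embedding_def
  proof (intro conjI ballI)
    show "f ` Field r \<subseteq> Field (product_order {..<?d} c)" using fF Fld by blast
    show "inj_on f (Field r)"
    proof (rule inj_onI)
      fix x y assume xy: "x \<in> Field r" "y \<in> Field r" "f x = f y"
      then have "(x, y) \<in> r" "(y, x) \<in> r" using le[OF xy(1,2)] le[OF xy(2,1)] by simp_all
      then show "x = y" using antisymD[OF asym] by blast
    qed
    show "(x, y) \<in> r \<longleftrightarrow> (f x, f y) \<in> product_order {..<?d} c"
      if "x \<in> Field r" "y \<in> Field r" for x y
    proof -
      have "(f x, f y) \<in> product_order {..<?d} c \<longleftrightarrow> (\<forall>i<?d. (f x i, f y i) \<in> c i)"
        using fF[of x] fF[of y] unfolding product_order_def Fc by blast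
      then show ?thesis using le[OF that] by (simp add: c_def)
    qed
  qed
  then have "embeds_in_chains r ?d c" unfolding embeds_in_chains_def using lin by blast
  then have "\<exists>c :: nat \<Rightarrow> 'a rel. embeds_in_chains r ?d c" by (rule embeds_in_chains_transfer)
  then show ?thesis unfolding dm_dim_def by (rule LeastI)
qed

lemma multiset_layers_iff:
  "(S, T) \<in> multiset_layers n k l \<longleftrightarrow>
     set_mset S \<subseteq> {1..n} \<and> k \<le> size S \<and> size S \<le> l \<and>
     set_mset T \<subseteq> {1..n} \<and> k \<le> size T \<and> size T \<le> l \<and> S \<subseteq># T"
  unfolding multiset_layers_def multiset_poset_def by blast

lemma Field_multiset_layers:
  "Field (multiset_layers n k l) = {S. set_mset S \<subseteq> {1..n} \<and> k \<le> size S \<and> size S \<le> l}"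
proof -
  have "S \<in> Field (multiset_layers n k l) \<longleftrightarrow> (S, S) \<in> multiset_layers n k l" for S
    unfolding Field_def Domain_iff Range_iff Un_iff multiset_layers_iff by blast
  then show ?thesis by (auto simp: multiset_layers_iff)
qed

lemma Partial_order_multiset_layers: "Partial_order (multiset_layers n k l)"
proof -
  have "trans (multiset_layers n k l)"
    by (rule transI) (simp add: multiset_layers_iff, blast intro: subset_mset.order_trans)
  moreover have "antisym (multiset_layers n k l)"
    by (rule antisymI) (simp add: multiset_layers_iff subset_mset.antisym)
  moreover have "Refl (multiset_layers n k l)"
    unfolding refl_on_def Field_multiset_layers by (simp add: multiset_layers_iff)
  moreover have "multiset_layers n k l \<subseteq>
      Field (multiset_layers n k l) \<times> Field (multiset_layers n k l)"
    by (auto intro: FieldI1 FieldI2)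
  ultimately show ?thesis by (simp add: order_on_defs)
qed

lemma finite_Field_multiset_layers: "finite (Field (multiset_layers n k l))"
proof -
  have "Field (multiset_layers n k l) \<subseteq> mset ` {xs. set xs \<subseteq> {1..n} \<and> length xs \<le> l}"
  proof
    fix S assume S: "S \<in> Field (multiset_layers n k l)"
    obtain xs where "S = mset xs" by (metis ex_mset)
    with S show "S \<in> mset ` {xs. set xs \<subseteq> {1..n} \<and> length xs \<le> l}"
      by (auto simp: Field_multiset_layers)
  qed
  then show ?thesis using finite_lists_length_le[of "{1..n}" l] by (auto intro: finite_subset)
qed

end

theory Submission
  imports Defs "HOL-Analysis.Harmonic_Numbers"
begin

text \<open>
  Put \<open>m = l - k\<close>. A set \<open>A \<subseteq> {1..n}\<close> yields two chains: order multisets by the size of their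
  restriction to \<open>A\<close>, and break ties between restrictions of equal size by an arbitrary
  enumeration or by its reverse. Together the two chains witness \<open>\<not> S \<subseteq># T\<close> unless the
  restrictions to \<open>A\<close> agree or that of \<open>S\<close> is strictly smaller. Now colour \<open>{1..n}\<close> with \<open>4m\<close>
  colours and use the colour classes as the sets \<open>A\<close>. Let \<open>X\<close> be the set of points where the
  multiplicities in \<open>S\<close> and \<open>T\<close> differ. If \<open>X\<close> meets more than \<open>m\<close> classes, some class is a witness,
  since otherwise \<open>|T| - |S| > m\<close>. If a point \<open>a\<close> of larger multiplicity in \<open>S\<close> is
  the only point of \<open>X\<close> in its class, that class is a witness. A random colouring does
  the former with probability at least 1/2 if \<open>|X| \<ge> 2m\<close> (look at \<open>2m\<close> points of \<open>X\<close>), and the latter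
  if \<open>|X| < 2m\<close>. As there are only \<open>n\<^sup>2\<^sup>m\<close> requirements, about \<open>2m log\<^sub>2 n\<close> greedily chosen colourings suffice.
\<close>

section \<open>Dimension bounds from families of subsets of the ground set\<close>

text \<open>Reduces a dimension bound to finding finitely many maps into one linear order. A single
  map may identify elements: antisymmetry of \<open>r\<close> makes the joint map injective.\<close>

lemma dm_dim_le_card:
  fixes r :: "'a rel" and g :: "'i \<Rightarrow> 'a \<Rightarrow> 'c::linorder"
  assumes r: "Partial_order r" and fin: "finite I"
    and iff: "\<And>x y. x \<in> Field r \<Longrightarrow> y \<in> Field r \<Longrightarrow> (x, y) \<in> r \<longleftrightarrow> (\<forall>i\<in>I. g i x \<le> g i y)"
  shows "dm_dim r \<le> card I"
proof -
  let ?d = "card I"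
  obtain e where e: "bij_betw e {..<?d} I"
    using ex_bij_betw_nat_finite[OF fin] by (auto simp: atLeast0LessThan)
  have asym: "antisym r" using r by (auto simp: order_on_defs)
  have rfl: "(x, x) \<in> r" if "x \<in> Field r" for x
    using r that by (auto simp: order_on_defs refl_on_def)
  define c :: "nat \<Rightarrow> 'c rel" where "c = (\<lambda>_. {(a, b). a \<le> b})"
  have Fc: "Field (c i) = UNIV" for i by (auto simp: c_def Field_def)
  have lin: "Linear_order (c i)" for i
    unfolding order_on_defs Fc
    by (auto simp: c_def refl_on_def trans_def antisym_def total_on_def)
  define f where "f = (\<lambda>x. \<lambda>i\<in>{..<?d}. g (e i) x)"
  have Fld: "Field (product_order {..<?d} c) = (\<Pi>\<^sub>E i\<in>{..<?d}. UNIV)"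
    using Field_product_order[of "{..<?d}" c] lin by (simp add: order_on_defs Fc)
  have fF: "f x \<in> (\<Pi>\<^sub>E i\<in>{..<?d}. UNIV)" for x by (simp add: f_def)
  have le: "(x, y) \<in> r \<longleftrightarrow> (f x, f y) \<in> product_order {..<?d} c"
    if "x \<in> Field r" "y \<in> Field r" for x y
  proof -
    have "(f x, f y) \<in> product_order {..<?d} c \<longleftrightarrow> (\<forall>i<?d. (f x i, f y i) \<in> c i)"
      using fF[of x] fF[of y] unfolding product_order_def Fc by blast
    also have "\<dots> \<longleftrightarrow> (\<forall>j\<in>e ` {..<?d}. g j x \<le> g j y)"
      by (auto simp: c_def f_def)
    also have "e ` {..<?d} = I" using e by (simp add: bij_betw_def)
    finally show ?thesis using iff[OF that] by blast
  qed
  have "inj_on f (Field r)"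
  proof (rule inj_onI)
    fix x y assume xy: "x \<in> Field r" "y \<in> Field r" "f x = f y"
    have "(x, y) \<in> r" "(y, x) \<in> r"
      using xy le[OF xy(1,1)] le[OF xy(1,2)] le[OF xy(2,1)] rfl[OF xy(1)] by simp_all
    then show "x = y" using antisymD[OF asym] by blast
  qed
  then have "order_embedding r (product_order {..<?d} c) f"
    unfolding order_embedding_def using Fld fF le by blast
  then have "embeds_in_chains r ?d c" unfolding embeds_in_chains_def using lin by blast
  then show ?thesis by (rule dm_dim_le)
qed

text \<open>Exactly the case in which one of the two chains of \<open>A\<close> puts
  \<open>S\<close> strictly above \<open>T\<close>: either the sizes decide, or they tie and one of
  the two opposite tie-breaks does.\<close>

definition mset_witness :: "'a multiset \<Rightarrow> 'a multiset \<Rightarrow> 'a set \<Rightarrow> bool" where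
  "mset_witness S T A \<longleftrightarrow>
     size {#x \<in># S. x \<in> A#} \<ge> size {#x \<in># T. x \<in> A#} \<and> {#x \<in># S. x \<in> A#} \<noteq> {#x \<in># T. x \<in> A#}"

lemma dm_dim_multiset_layers_le:
  fixes \<A> :: "nat set set"
  assumes fin: "finite \<A>"
    and wit: "\<And>S T. S \<in> Field (multiset_layers n k l) \<Longrightarrow> T \<in> Field (multiset_layers n k l) \<Longrightarrow>
                \<not> S \<subseteq># T \<Longrightarrow> \<exists>A\<in>\<A>. mset_witness S T A"
  shows "dm_dim (multiset_layers n k l) \<le> 2 * card \<A>"
proof -
  \<comment> \<open>The lower size bound is 0 because a restriction to \<open>A\<close> may have
    fewer than \<open>k\<close> elements.\<close>
  define D where "D = Field (multiset_layers n 0 l)"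
  have "finite D" unfolding D_def by (rule finite_Field_multiset_layers)
  then obtain e :: "nat multiset \<Rightarrow> nat" and M where im: "e ` D = {i. i < M}" and inj: "inj_on e D"
    using finite_imp_inj_to_nat_seg[of D] by auto
  have eM: "e R < M" if "R \<in> D" for R using imageI[OF that, of e] im by simp
  let ?r = "\<lambda>A S :: nat multiset. {#x \<in># S. x \<in> A#}"
  have rD: "?r A S \<in> D" if "S \<in> Field (multiset_layers n k l)" for A S
    using that order_trans[OF size_filter_mset_lesseq[of "\<lambda>x. x \<in> A" S]]
    by (auto simp: D_def Field_multiset_layers)
  \<comment> \<open>Lexicographic order packed into one integer: as \<open>e\<close> takes values in
    \<open>[0, M)\<close> on \<open>D\<close>, one unit of size outweighs any tie-break. The flag
    \<open>b\<close> selects the enumeration or its reverse.\<close>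
  define g :: "nat set \<times> bool \<Rightarrow> nat multiset \<Rightarrow> int" where
    "g = (\<lambda>(A, b) S. int M * int (size (?r A S)) + (if b then int (e (?r A S)) else - int (e (?r A S))))"
  have size_less: "g (A, b) S < g (A, b) T"
    if "S \<in> Field (multiset_layers n k l)" "T \<in> Field (multiset_layers n k l)"
      "size (?r A S) < size (?r A T)" for A b S T
  proof -
    have "int M * (int (size (?r A S)) + 1) \<le> int M * int (size (?r A T))"
      using that(3) by (intro mult_left_mono) auto
    then show ?thesis
      using eM[OF rD[OF that(1), of A]] eM[OF rD[OF that(2), of A]] by (simp add: g_def algebra_simps)
  qed
  have "dm_dim (multiset_layers n k l) \<le> card (\<A> \<times> (UNIV :: bool set))"
  proof (rule dm_dim_le_card[where g = g, OF Partial_order_multiset_layers])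
    show "finite (\<A> \<times> (UNIV :: bool set))" using fin by simp
    fix S T assume S: "S \<in> Field (multiset_layers n k l)" and T: "T \<in> Field (multiset_layers n k l)"
    have "(S, T) \<in> multiset_layers n k l \<longleftrightarrow> S \<subseteq># T"
      using S T by (auto simp: multiset_layers_iff Field_multiset_layers)
    also have "\<dots> \<longleftrightarrow> (\<forall>i\<in>\<A> \<times> UNIV. g i S \<le> g i T)"
    proof
      assume ST: "S \<subseteq># T"
      \<comment> \<open>Restriction preserves inclusion, and a proper submultiset has smaller size,
        so ties arise only between equal restrictions.\<close>
      have "g (A, b) S \<le> g (A, b) T" for A b
      proof -
        have sub: "?r A S \<subseteq># ?r A T" using ST by (rule multiset_filter_mono)
        show ?thesis
        proof (cases "?r A S = ?r A T")
          case True
          then show ?thesis by (simp add: g_def)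
        next
          case False
          with sub have "size (?r A S) < size (?r A T)"
            by (simp add: mset_subset_size subset_mset.le_neq_trans)
          then show ?thesis using size_less[OF S T, of A b] by simp
        qed
      qed
      then show "\<forall>i\<in>\<A> \<times> UNIV. g i S \<le> g i T" by auto
    next
      assume le: "\<forall>i\<in>\<A> \<times> UNIV. g i S \<le> g i T"
      show "S \<subseteq># T"
      proof (rule ccontr)
        assume "\<not> S \<subseteq># T"
        then obtain A where A: "A \<in> \<A>" "mset_witness S T A" using wit[OF S T] by blast
        have g: "g (A, b) S \<le> g (A, b) T" for b using le A(1) by blast
        then have "\<not> size (?r A T) < size (?r A S)"
          using size_less[OF T S, of A True] by (meson not_le)
        then have "size (?r A T) = size (?r A S)"
          using A(2) by (simp add: mset_witness_def)
        moreover have "e (?r A S) \<noteq> e (?r A T)"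
          using inj rD[OF S, of A] rD[OF T, of A] A(2) by (auto simp: mset_witness_def inj_on_def)
        \<comment> \<open>At equal sizes the two chains give opposite inequalities between the
          values of \<open>e\<close>, so these would coincide.\<close>
        ultimately show False using g[of True] g[of False] by (simp add: g_def)
      qed
    qed
    finally show "(S, T) \<in> multiset_layers n k l \<longleftrightarrow> (\<forall>i\<in>\<A> \<times> UNIV. g i S \<le> g i T)" .
  qed
  then show ?thesis by (simp add: card_cartesian_product mult.commute)
qed

text \<open>Restricted to \<open>A\<close>, \<open>T\<close> becomes a proper submultiset of
  \<open>S\<close>.\<close>

lemma mset_witness_isolated:
  assumes "count T a < count S a" "a \<in> A"
    and "\<And>x. x \<in> A \<Longrightarrow> x \<noteq> a \<Longrightarrow> count S x = count T x"
  shows "mset_witness S T A"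
proof -
  have "{#x \<in># T. x \<in> A#} \<subset># {#x \<in># S. x \<in> A#}"
  proof (rule subset_mset.le_neq_trans)
    show "{#x \<in># T. x \<in> A#} \<subseteq># {#x \<in># S. x \<in> A#}"
      using assms by (auto simp: subseteq_mset_def) (metis less_imp_le order_refl)
    show "{#x \<in># T. x \<in> A#} \<noteq> {#x \<in># S. x \<in> A#}"
    proof
      assume "{#x \<in># T. x \<in> A#} = {#x \<in># S. x \<in> A#}"
      then have "count {#x \<in># T. x \<in> A#} a = count {#x \<in># S. x \<in> A#} a" by simp
      then show False using assms by simp
    qed
  qed
  then show ?thesis
    using mset_subset_size by (force simp: mset_witness_def)
qed

text \<open>Singletons already witness every failure of inclusion. This serves the smallest case of
  the theorem, where the colouring bound is too weak.\<close>

lemma dm_dim_multiset_layers_le_ground: "dm_dim (multiset_layers n k l) \<le> 2 * n"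
proof -
  have "dm_dim (multiset_layers n k l) \<le> 2 * card ((\<lambda>a. {a}) ` {1..n})"
  proof (rule dm_dim_multiset_layers_le)
    fix S T assume S: "S \<in> Field (multiset_layers n k l)" and nle: "\<not> S \<subseteq># T"
    then obtain a where a: "count T a < count S a" by (auto simp: subseteq_mset_def not_le)
    then have "a \<in># S" by (metis count_inI not_less0)
    then have "a \<in> {1..n}" using S by (auto simp: Field_multiset_layers)
    with a show "\<exists>A\<in>(\<lambda>a. {a}) ` {1..n}. mset_witness S T A"
      by (auto intro!: bexI[of _ a] mset_witness_isolated)
  qed simp
  then show ?thesis by (simp add: card_image)
qed

section \<open>Witnesses among the colour classes\<close>

lemma size_eq_sum_classes:
  fixes S :: "'a multiset"
  assumes "finite C" "\<And>x. x \<in># S \<Longrightarrow> f x \<in> C"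
  shows "size S = (\<Sum>i\<in>C. size {#x \<in># S. f x = i#})"
  using assms(2)
proof (induction S)
  case empty
  then show ?case by simp
next
  case (add x S)
  have "(\<Sum>i\<in>C. size {#y \<in># add_mset x S. f y = i#}) =
      (\<Sum>i\<in>C. size {#y \<in># S. f y = i#} + (if f x = i then 1 else 0))"
    by (intro sum.cong) auto
  then show ?case using add assms(1) by (simp add: sum.distrib)
qed

text \<open>A class that is no witness holds at least as much of \<open>T\<close> as of
  \<open>S\<close>, and strictly more if it meets \<open>Y\<close>. Summing over all classes
  contradicts the size assumption.\<close>

lemma mset_witness_many_classes:
  fixes S T :: "'a multiset"
  assumes C: "finite C" and fS: "\<And>x. x \<in># S \<Longrightarrow> f x \<in> C" and fT: "\<And>x. x \<in># T \<Longrightarrow> f x \<in> C"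
    and Y: "\<And>y. y \<in> Y \<Longrightarrow> count S y \<noteq> count T y"
    and card: "size T < size S + card (f ` Y)"
  shows "\<exists>i\<in>C. mset_witness S T {x. f x = i}"
proof (rule ccontr)
  assume no: "\<not> ?thesis"
  have fY: "f ` Y \<subseteq> C"
  proof (rule image_subsetI)
    fix y assume "y \<in> Y"
    then have "y \<in># S \<or> y \<in># T" using Y by (metis count_inI)
    then show "f y \<in> C" using fS fT by blast
  qed
  have "size {#x \<in># S. f x = i#} + (if i \<in> f ` Y then 1 else 0) \<le> size {#x \<in># T. f x = i#}"
    if i: "i \<in> C" for i
  proof (cases "{#x \<in># S. f x = i#} = {#x \<in># T. f x = i#}")
    case True
    have "i \<notin> f ` Y"
    proof
      assume "i \<in> f ` Y"
      then obtain y where y: "y \<in> Y" "f y = i" by blast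
      have "count {#x \<in># S. f x = i#} y = count {#x \<in># T. f x = i#} y" using True by simp
      then show False using y Y by simp
    qed
    then show ?thesis using True by simp
  next
    case False
    then show ?thesis using no i by (auto simp: mset_witness_def)
  qed
  then have "(\<Sum>i\<in>C. size {#x \<in># S. f x = i#} + (if i \<in> f ` Y then 1 else 0))
      \<le> (\<Sum>i\<in>C. size {#x \<in># T. f x = i#})"
    by (rule sum_mono)
  moreover have "(\<Sum>i\<in>C. if i \<in> f ` Y then 1 else 0 :: nat) = card (f ` Y)"
    using C fY by (simp add: sum.If_cases Int_absorb1)
  ultimately show False
    using card size_eq_sum_classes[of C S f] size_eq_sum_classes[of C T f] C fS fT
    by (simp add: sum.distrib)
qed

section \<open>Counting bad colourings\<close>

text \<open>Two points collide with probability at most \<open>1 / card C\<close>. Recolouring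
  \<open>x\<close> arbitrarily is injective on colliding functions, because the lost value
  \<open>f x\<close> survives as \<open>f y\<close>.\<close>

lemma card_PiE_collision:
  assumes I: "finite I" and C: "finite C" and x: "x \<in> I" and y: "y \<in> I" and xy: "x \<noteq> y"
  shows "card {f \<in> I \<rightarrow>\<^sub>E C. f x = f y} * card C \<le> card (I \<rightarrow>\<^sub>E C)"
proof -
  let ?B = "{f \<in> I \<rightarrow>\<^sub>E C. f x = f y}"
  have "card (?B \<times> C) \<le> card (I \<rightarrow>\<^sub>E C)"
  proof (rule card_inj_on_le[where f = "\<lambda>(f, c). f(x := c)"])
    show "inj_on (\<lambda>(f, c). f(x := c)) (?B \<times> C)"
    proof (rule inj_onI, clarsimp)
      fix f c g d assume h: "f x = f y" "g x = g y" "f(x := c) = g(x := d)"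
      have "f z = g z" for z
        using fun_cong[OF h(3), of z] fun_cong[OF h(3), of y] h(1,2) xy by (cases "z = x") auto
      moreover have "c = d" using fun_cong[OF h(3), of x] by simp
      ultimately show "f = g \<and> c = d" by auto
    qed
    show "(\<lambda>(f, c). f(x := c)) ` (?B \<times> C) \<subseteq> I \<rightarrow>\<^sub>E C"
      using x by (auto simp: PiE_iff extensional_def)
    show "finite (I \<rightarrow>\<^sub>E C)" using I C by (intro finite_PiE) auto
  qed
  then show ?thesis by (simp add: card_cartesian_product)
qed

text \<open>Union bound over the possible collisions of \<open>a\<close> with the other points of
  \<open>Y\<close>.\<close>

lemma card_PiE_not_isolated:
  assumes I: "finite I" and C: "finite C" and Y: "Y \<subseteq> I" and a: "a \<in> Y"
  shows "card {f \<in> I \<rightarrow>\<^sub>E C. \<exists>y\<in>Y - {a}. f y = f a} * card C \<le> (card Y - 1) * card (I \<rightarrow>\<^sub>E C)"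
proof -
  have finY: "finite Y" using I Y finite_subset by blast
  have "{f \<in> I \<rightarrow>\<^sub>E C. \<exists>y\<in>Y - {a}. f y = f a} = (\<Union>y\<in>Y - {a}. {f \<in> I \<rightarrow>\<^sub>E C. f y = f a})"
    by blast
  then have "card {f \<in> I \<rightarrow>\<^sub>E C. \<exists>y\<in>Y - {a}. f y = f a} \<le> (\<Sum>y\<in>Y - {a}. card {f \<in> I \<rightarrow>\<^sub>E C. f y = f a})"
    using card_UN_le[of "Y - {a}" "\<lambda>y. {f \<in> I \<rightarrow>\<^sub>E C. f y = f a}"] finY by simp
  then have "card {f \<in> I \<rightarrow>\<^sub>E C. \<exists>y\<in>Y - {a}. f y = f a} * card C
      \<le> (\<Sum>y\<in>Y - {a}. card {f \<in> I \<rightarrow>\<^sub>E C. f y = f a} * card C)"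
    by (simp add: sum_distrib_right[symmetric])
  also have "\<dots> \<le> (\<Sum>y\<in>Y - {a}. card (I \<rightarrow>\<^sub>E C))"
    using Y a by (intro sum_mono card_PiE_collision I C) auto
  also have "\<dots> = (card Y - 1) * card (I \<rightarrow>\<^sub>E C)" using a finY by simp
  finally show ?thesis .
qed

text \<open>Each colour has one least point in \<open>Y\<close>; these form \<open>?R\<close>. Every
  other point is the larger member of a monochromatic pair.\<close>

lemma card_le_image_plus_collisions:
  fixes Y :: "'a::linorder set"
  assumes fin: "finite Y"
  shows "card Y \<le> card (f ` Y) + card {(x, y). x \<in> Y \<and> y \<in> Y \<and> x < y \<and> f x = f y}"
proof -
  let ?R = "{y \<in> Y. \<forall>x\<in>Y. f x = f y \<longrightarrow> y \<le> x}"
  let ?P = "{(x, y). x \<in> Y \<and> y \<in> Y \<and> x < y \<and> f x = f y}"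
  have finP: "finite ?P" using fin by (rule finite_subset[rotated, OF finite_cartesian_product]) (use fin in auto)
  have "inj_on f ?R" by (rule inj_onI) (auto intro: antisym)
  then have R: "card ?R \<le> card (f ` Y)"
    using fin by (intro card_inj_on_le) auto
  have "Y \<subseteq> ?R \<union> snd ` ?P" by (force simp: not_le)
  then have "card Y \<le> card (?R \<union> snd ` ?P)" using fin finP by (intro card_mono) auto
  also have "\<dots> \<le> card ?R + card (snd ` ?P)" by (rule card_Un_le)
  also have "\<dots> \<le> card (f ` Y) + card ?P" using R card_image_le[OF finP, of snd] by linarith
  finally show ?thesis .
qed

lemma card_ordered_pairs:
  fixes Y :: "'a::linorder set"
  assumes fin: "finite Y"
  shows "2 * card {(x, y). x \<in> Y \<and> y \<in> Y \<and> x < y} = card Y * (card Y - 1)"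
proof -
  let ?P = "{(x, y). x \<in> Y \<and> y \<in> Y \<and> x < y}"
  let ?D = "(\<lambda>x. (x, x)) ` Y"
  have finP: "finite ?P" by (rule finite_subset[of _ "Y \<times> Y"]) (use fin in auto)
  have "card Y * card Y = card (Y \<times> Y)" by (simp add: card_cartesian_product)
  also have "Y \<times> Y = (?P \<union> prod.swap ` ?P) \<union> ?D" by (auto simp: image_iff)
  also have "card \<dots> = card (?P \<union> prod.swap ` ?P) + card ?D"
    using fin finP by (intro card_Un_disjoint) auto
  also have "card (?P \<union> prod.swap ` ?P) = card ?P + card (prod.swap ` ?P)"
    using finP by (intro card_Un_disjoint) auto
  also have "card (prod.swap ` ?P) = card ?P" by (rule card_image) simp
  also have "card ?D = card Y" by (rule card_image) (auto simp: inj_on_def)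
  finally show ?thesis by (simp add: diff_mult_distrib2)
qed

text \<open>Markov's inequality for the number of monochromatic pairs: a bad colouring has at least
  \<open>m\<close> of them, while the mean is at most
  \<open>m * (2 * m - 1) / card C\<close>.\<close>

lemma card_PiE_few_classes:
  fixes I :: "'a::linorder set"
  assumes I: "finite I" and C: "finite C" and Y: "Y \<subseteq> I" "card Y = 2 * m" and m: "m > 0"
  shows "card {f \<in> I \<rightarrow>\<^sub>E C. card (f ` Y) \<le> m} * card C \<le> (2 * m - 1) * card (I \<rightarrow>\<^sub>E C)"
proof -
  have finY: "finite Y" using I Y finite_subset by blast
  have finF: "finite (I \<rightarrow>\<^sub>E C)" using I C by (intro finite_PiE) auto
  let ?B = "{f \<in> I \<rightarrow>\<^sub>E C. card (f ` Y) \<le> m}"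
  let ?P = "{(x, y). x \<in> Y \<and> y \<in> Y \<and> x < y}"
  have finP: "finite ?P" by (rule finite_subset[of _ "Y \<times> Y"]) (use finY in auto)
  have "m * card ?B = (\<Sum>f\<in>?B. m)" by simp
  also have "\<dots> \<le> (\<Sum>f\<in>?B. card {p \<in> ?P. f (fst p) = f (snd p)})"
  proof (rule sum_mono)
    fix f assume "f \<in> ?B"
    moreover have "{p \<in> ?P. f (fst p) = f (snd p)} = {(x, y). x \<in> Y \<and> y \<in> Y \<and> x < y \<and> f x = f y}"
      by auto
    ultimately show "m \<le> card {p \<in> ?P. f (fst p) = f (snd p)}"
      using card_le_image_plus_collisions[OF finY, of f] Y(2) by simp
  qed
  also have "\<dots> \<le> (\<Sum>f\<in>I \<rightarrow>\<^sub>E C. card {p \<in> ?P. f (fst p) = f (snd p)})"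
    using finF by (intro sum_mono2) auto
  \<comment> \<open>Double counting of the incidences between colourings and their monochromatic
    pairs.\<close>
  also have "\<dots> = (\<Sum>p\<in>?P. card {f \<in> I \<rightarrow>\<^sub>E C. f (fst p) = f (snd p)})"
    by (rule sum_multicount_gen[OF finF finP]) auto
  finally have "m * card ?B * card C \<le> (\<Sum>p\<in>?P. card {f \<in> I \<rightarrow>\<^sub>E C. f (fst p) = f (snd p)} * card C)"
    by (simp add: sum_distrib_right[symmetric])
  also have "\<dots> \<le> (\<Sum>p\<in>?P. card (I \<rightarrow>\<^sub>E C))"
    using Y(1) by (intro sum_mono card_PiE_collision I C) auto
  also have "\<dots> = card ?P * card (I \<rightarrow>\<^sub>E C)" by simp
  also have "card ?P = m * (2 * m - 1)" using card_ordered_pairs[OF finY] Y(2) by simp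
  finally show ?thesis using m by simp
qed

section \<open>Choosing few colourings that meet all requirements\<close>

text \<open>By averaging, some \<open>f\<close> meets at least half of the requirements still open;
  adding it to \<open>G\<close> halves their number.\<close>

lemma greedy_halving_cover:
  fixes good :: "'a \<Rightarrow> 'b \<Rightarrow> bool"
  assumes finF: "finite F" and "F \<noteq> {}" and finR: "finite R"
    and half: "\<And>x. x \<in> R \<Longrightarrow> card F \<le> 2 * card {f \<in> F. good f x}"
  shows "\<exists>G. G \<subseteq> F \<and> card G \<le> N \<and> 2 ^ N * card {x \<in> R. \<forall>f\<in>G. \<not> good f x} \<le> card R"
proof (induction N)
  case 0
  show ?case using assms by (intro exI[of _ "{}"]) simp
next
  case (Suc N)
  then obtain G where G: "G \<subseteq> F" "card G \<le> N" "2 ^ N * card {x \<in> R. \<forall>f\<in>G. \<not> good f x} \<le> card R"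
    by blast
  let ?U = "{x \<in> R. \<forall>f\<in>G. \<not> good f x}"
  have finU: "finite ?U" using finR by simp
  \<comment> \<open>Otherwise counting the pairs of a function and an open requirement it meets, by
    functions and by requirements, contradicts \<open>half\<close>.\<close>
  have "\<exists>f\<in>F. card ?U \<le> 2 * card {x \<in> ?U. good f x}"
  proof (rule ccontr)
    assume "\<not> ?thesis"
    then have "(\<Sum>f\<in>F. 2 * card {x \<in> ?U. good f x}) < (\<Sum>f\<in>F. card ?U)"
      using finF \<open>F \<noteq> {}\<close> by (intro sum_strict_mono) (auto simp: not_le)
    moreover have "(\<Sum>f\<in>F. card {x \<in> ?U. good f x}) = (\<Sum>x\<in>?U. card {f \<in> F. good f x})"
      by (rule sum_multicount_gen[OF finF finU]) auto
    ultimately have "(\<Sum>x\<in>?U. 2 * card {f \<in> F. good f x}) < card F * card ?U"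
      by (simp add: sum_distrib_left[symmetric])
    moreover have "(\<Sum>x\<in>?U. card F) \<le> (\<Sum>x\<in>?U. 2 * card {f \<in> F. good f x})"
      using half by (intro sum_mono) simp
    ultimately show False by (simp add: mult.commute)
  qed
  then obtain f where f: "f \<in> F" "card ?U \<le> 2 * card {x \<in> ?U. good f x}" by blast
  have "?U = {x \<in> ?U. good f x} \<union> {x \<in> R. \<forall>g\<in>insert f G. \<not> good g x}" by auto
  moreover have "card ({x \<in> ?U. good f x} \<union> {x \<in> R. \<forall>g\<in>insert f G. \<not> good g x}) =
      card {x \<in> ?U. good f x} + card {x \<in> R. \<forall>g\<in>insert f G. \<not> good g x}"
    using finR by (intro card_Un_disjoint) auto
  ultimately have "card ?U = card {x \<in> ?U. good f x} + card {x \<in> R. \<forall>g\<in>insert f G. \<not> good g x}"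
    by (rule trans[OF arg_cong[where f = card]])
  with f(2) have "2 * card {x \<in> R. \<forall>g\<in>insert f G. \<not> good g x} \<le> card ?U" by linarith
  then have "2 ^ N * (2 * card {x \<in> R. \<forall>g\<in>insert f G. \<not> good g x}) \<le> 2 ^ N * card ?U"
    by (rule mult_left_mono) simp
  also note G(3)
  finally have "2 ^ Suc N * card {x \<in> R. \<forall>g\<in>insert f G. \<not> good g x} \<le> card R"
    by (simp add: ac_simps)
  moreover have "card (insert f G) \<le> Suc N"
    using G(2) card_insert_le_m1[of "Suc N" G f] by simp
  ultimately show ?case using G(1) f(1) by (intro exI[of _ "insert f G"]) auto
qed

text \<open>
  Both kinds of requirement are indexed by words of length \<open>2m\<close>: a word with distinct letters asks
  for many classes, a word with a repetition asks that its first letter be isolated.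
\<close>

lemma exists_colourings:
  fixes I :: "'a::linorder set"
  assumes I: "finite I" and m: "m > 0" and N: "card I ^ (2 * m) < 2 ^ N"
  obtains G :: "('a \<Rightarrow> nat) set" where "finite G" "card G \<le> N" "G \<subseteq> I \<rightarrow>\<^sub>E {..<4 * m}"
    and "\<And>Y. Y \<subseteq> I \<Longrightarrow> card Y = 2 * m \<Longrightarrow> \<exists>f\<in>G. m < card (f ` Y)"
    and "\<And>Y a. Y \<subseteq> I \<Longrightarrow> card Y < 2 * m \<Longrightarrow> a \<in> Y \<Longrightarrow> \<exists>f\<in>G. \<forall>y\<in>Y - {a}. f y \<noteq> f a"
proof -
  define C where "C = {..<4 * m}"
  define F where "F = I \<rightarrow>\<^sub>E C"
  define R where "R = {xs. set xs \<subseteq> I \<and> length xs = 2 * m}"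
  define good :: "('a \<Rightarrow> nat) \<Rightarrow> 'a list \<Rightarrow> bool" where
    "good = (\<lambda>f xs. if distinct xs then m < card (f ` set xs)
                     else \<forall>y\<in>set xs - {hd xs}. f y \<noteq> f (hd xs))"
  have C: "finite C" "card C = 4 * m" by (simp_all add: C_def)
  have finF: "finite F" unfolding F_def using I C by (intro finite_PiE) auto
  have "C \<noteq> {}" using m C(2) by auto
  then have "F \<noteq> {}" by (simp add: F_def PiE_eq_empty_iff)
  have R: "finite R" "card R = card I ^ (2 * m)"
    using I by (simp_all add: R_def finite_lists_length_eq card_lists_length_eq)
  have half: "card F \<le> 2 * card {f \<in> F. good f xs}" if xs: "xs \<in> R" for xs
  proof -
    \<comment> \<open>Both kinds of requirement fail with probability at most
      \<open>(2 * m - 1) / (4 * m)\<close>, below one half; this is why \<open>4 * m\<close> colours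
      are used.\<close>
    have "card {f \<in> F. \<not> good f xs} * card C \<le> (2 * m - 1) * card F"
    proof (cases "distinct xs")
      case True
      then show ?thesis
        using card_PiE_few_classes[OF I C(1), of "set xs" m] xs m
        by (simp add: good_def F_def R_def distinct_card not_less)
    next
      case False
      then have "card (set xs) < 2 * m"
        using xs card_length[of xs] card_distinct[of xs] by (fastforce simp: R_def)
      then have le: "(card (set xs) - 1) * card F \<le> (2 * m - 1) * card F" by (intro mult_right_mono) auto
      have "hd xs \<in> set xs" using xs m by (cases xs) (auto simp: R_def)
      then have "card {f \<in> F. \<not> good f xs} * card C \<le> (card (set xs) - 1) * card F"
        using card_PiE_not_isolated[OF I C(1), of "set xs" "hd xs"] xs False
        by (simp add: good_def F_def R_def)
      then show ?thesis using le by (rule order_trans)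
    qed
    then have "2 * m * (2 * card {f \<in> F. \<not> good f xs}) \<le> (2 * m - 1) * card F" by (simp add: C(2) ac_simps)
    also have "\<dots> \<le> 2 * m * card F" by (intro mult_right_mono) auto
    finally have "2 * card {f \<in> F. \<not> good f xs} \<le> card F" using m by simp
    moreover have "card F = card {f \<in> F. good f xs} + card {f \<in> F. \<not> good f xs}"
      using finF by (subst card_Un_disjoint[symmetric]) (auto intro: arg_cong[where f = card])
    ultimately show ?thesis by linarith
  qed
  obtain G where G: "G \<subseteq> F" "card G \<le> N" "2 ^ N * card {xs \<in> R. \<forall>f\<in>G. \<not> good f xs} \<le> card R"
    using greedy_halving_cover[where good = good and N = N, OF finF \<open>F \<noteq> {}\<close> R(1) half] by blast
  \<comment> \<open>After \<open>N\<close> halvings fewer than one requirement is left.\<close>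
  have "card {xs \<in> R. \<forall>f\<in>G. \<not> good f xs} = 0"
  proof (rule ccontr)
    assume "card {xs \<in> R. \<forall>f\<in>G. \<not> good f xs} \<noteq> 0"
    then have "2 ^ N * 1 \<le> 2 ^ N * card {xs \<in> R. \<forall>f\<in>G. \<not> good f xs}"
      by (intro mult_left_mono) auto
    with G(3) R(2) N show False by linarith
  qed
  then have cover: "\<exists>f\<in>G. good f xs" if "xs \<in> R" for xs using that R(1) by auto
  show thesis
  proof (rule that[of G])
    show "finite G" using G(1) finF finite_subset by blast
    show "G \<subseteq> I \<rightarrow>\<^sub>E {..<4 * m}" using G(1) by (simp add: F_def C_def)
    show "\<exists>f\<in>G. m < card (f ` Y)" if Y: "Y \<subseteq> I" "card Y = 2 * m" for Y
    proof -
      obtain xs where xs: "set xs = Y" "distinct xs"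
        using finite_distinct_list[of Y] I Y(1) finite_subset by blast
      then have "xs \<in> R" using Y distinct_card[of xs] by (simp add: R_def)
      then show ?thesis using cover xs by (fastforce simp: good_def)
    qed
    show "\<exists>f\<in>G. \<forall>y\<in>Y - {a}. f y \<noteq> f a" if Y: "Y \<subseteq> I" "card Y < 2 * m" "a \<in> Y" for Y a
    proof -
      obtain ys where ys: "set ys = Y" "distinct ys"
        using finite_distinct_list[of Y] I Y(1) finite_subset by blast
      then have len: "length ys < 2 * m" using Y distinct_card[of ys] by simp
      \<comment> \<open>Padding in front with copies of \<open>a\<close> makes \<open>a\<close> the
        first letter; since \<open>Y\<close> has fewer than \<open>2 * m\<close> points, a letter
        repeats.\<close>
      define xs where "xs = replicate (2 * m - length ys) a @ ys"
      have set_xs: "set xs = Y" using ys Y(3) by (auto simp: xs_def)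
      have hd_xs: "hd xs = a" using len by (simp add: xs_def hd_append)
      have len_xs: "length xs = 2 * m" using len by (simp add: xs_def)
      have "\<not> distinct xs" using distinct_card[of xs] Y(2) set_xs len_xs by auto
      moreover have "xs \<in> R" using set_xs len_xs Y(1) by (simp add: R_def)
      ultimately show ?thesis using cover[of xs] set_xs hd_xs by (auto simp: good_def)
    qed
  qed (fact G(2))
qed

section \<open>Assembling the dimension bound\<close>

text \<open>The bound counts two chains for each of the \<open>4 * m\<close> classes of each of at
  most \<open>N\<close> colourings.\<close>

lemma dm_dim_multiset_layers_le_colourings:
  assumes m: "l \<le> k + m" "m > 0" and N: "n ^ (2 * m) < 2 ^ N"
  shows "dm_dim (multiset_layers n k l) \<le> 8 * m * N"
proof -
  have "card {1..n} ^ (2 * m) < 2 ^ N" using N by simp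
  then obtain G :: "(nat \<Rightarrow> nat) set" where G: "finite G" "card G \<le> N" "G \<subseteq> {1..n} \<rightarrow>\<^sub>E {..<4 * m}"
    and many: "\<And>Y. Y \<subseteq> {1..n} \<Longrightarrow> card Y = 2 * m \<Longrightarrow> \<exists>f\<in>G. m < card (f ` Y)"
    and isolated: "\<And>Y a. Y \<subseteq> {1..n} \<Longrightarrow> card Y < 2 * m \<Longrightarrow> a \<in> Y \<Longrightarrow> \<exists>f\<in>G. \<forall>y\<in>Y - {a}. f y \<noteq> f a"
    using exists_colourings[OF finite_atLeastAtMost m(2)] by metis
  \<comment> \<open>The classes range over all naturals. Outside \<open>{1..n}\<close> a colouring
    is \<open>undefined\<close>, which may equal a colour, but there both multiplicities are
    0.\<close>
  define \<A> where "\<A> = (\<lambda>(f, i). {x. f x = i}) ` (G \<times> {..<4 * m})"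
  have "dm_dim (multiset_layers n k l) \<le> 2 * card \<A>"
  proof (rule dm_dim_multiset_layers_le)
    show "finite \<A>" using G(1) by (simp add: \<A>_def)
    fix S T assume S: "S \<in> Field (multiset_layers n k l)" and T: "T \<in> Field (multiset_layers n k l)"
      and nle: "\<not> S \<subseteq># T"
    have fS: "f x < 4 * m" if "f \<in> G" "x \<in># S" for f x
      using G(3) S that by (auto simp: Field_multiset_layers PiE_iff)
    have fT: "f x < 4 * m" if "f \<in> G" "x \<in># T" for f x
      using G(3) T that by (auto simp: Field_multiset_layers PiE_iff)
    define X where "X = {x. count S x \<noteq> count T x}"
    have "X \<subseteq> set_mset S \<union> set_mset T" unfolding X_def by (auto simp: not_in_iff)
    then have XI: "X \<subseteq> {1..n}" using S T by (auto simp: Field_multiset_layers)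
    obtain a where a: "count T a < count S a" using nle by (auto simp: subseteq_mset_def not_le)
    have aS: "a \<in># S" using a by (metis count_inI not_less0)
    show "\<exists>A\<in>\<A>. mset_witness S T A"
    proof (cases "card X < 2 * m")
      case True
      then obtain f where f: "f \<in> G" "\<forall>y\<in>X - {a}. f y \<noteq> f a"
        using isolated[OF XI, of a] a by (auto simp: X_def)
      have "mset_witness S T {x. f x = f a}"
        using f(2) a by (intro mset_witness_isolated[of T a S]) (auto simp: X_def)
      moreover have "{x. f x = f a} \<in> \<A>" using f(1) fS[OF f(1) aS] by (auto simp: \<A>_def)
      ultimately show ?thesis by blast
    next
      case False
      then obtain Y where Y: "Y \<subseteq> X" "card Y = 2 * m"
        using obtain_subset_with_card_n[of "2 * m" X] by (auto simp: not_less)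
      then obtain f where f: "f \<in> G" "m < card (f ` Y)" using many[of Y] XI by blast
      \<comment> \<open>The sizes differ by at most \<open>l - k\<close>, hence by at most
        \<open>m\<close>.\<close>
      have "size T < size S + card (f ` Y)"
        using S T f(2) m(1) by (simp add: Field_multiset_layers)
      then have "\<exists>i\<in>{..<4 * m}. mset_witness S T {x. f x = i}"
        using fS[OF f(1)] fT[OF f(1)] Y(1)
        by (intro mset_witness_many_classes[where Y = Y]) (auto simp: X_def)
      then show ?thesis using f(1) by (force simp: \<A>_def)
    qed
  qed
  also have "card \<A> \<le> card G * (4 * m)"
    unfolding \<A>_def using card_image_le[of "G \<times> {..<4 * m}"] G(1) by (force simp: card_cartesian_product)
  also have "card G * (4 * m) \<le> N * (4 * m)" using G(2) by simp
  finally show ?thesis by (simp add: ac_simps)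
qed

text \<open>The value \<open>n = 1\<close> is excluded: there the poset is a chain of at least two
  elements, of dimension 1, while \<open>ln 1 = 0\<close>.\<close>

theorem theorem1p5:
  fixes k l n :: nat
  assumes "k \<ge> 1" and "l \<ge> 1" and "n \<ge> 2" and "k < l"
  shows "real (dm_dim (multiset_layers n k l)) \<le> 34 * (real l - real k)\<^sup>2 * ln (real n)"
proof -
  define m where "m = l - k"
  have m: "m > 0" "l \<le> k + m" "real l - real k = real m" using assms by (auto simp: m_def)
  define L where "L = ln (real n)"
  have "ln 2 \<le> L" unfolding L_def using assms by simp
  then have L: "L \<ge> 2 / 3" using ln2_ge_two_thirds by linarith
  show ?thesis
  proof (cases "n = 2 \<and> m = 1")
    \<comment> \<open>The colouring bound would give \<open>8 * 1 * 3 = 24\<close>, just above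
      \<open>34 * ln 2\<close>. Two singletons give 4.\<close>
    case True
    then have "real (dm_dim (multiset_layers n k l)) \<le> 4"
      using dm_dim_multiset_layers_le_ground[of n k l] by simp
    also have "\<dots> \<le> 34 * L" using L by simp
    finally show ?thesis using True m(3) by (simp add: L_def)
  next
    case False
    \<comment> \<open>The least \<open>N\<close> with \<open>n ^ (2 * m) < 2 ^ N\<close>.\<close>
    define N where "N = nat \<lfloor>2 * real m * log 2 (real n)\<rfloor> + 1"
    have log: "log 2 (real n) \<ge> 0" using assms by simp
    then have N: "2 * real m * log 2 (real n) < real N" "real N \<le> 2 * real m * log 2 (real n) + 1"
      unfolding N_def by (simp_all add: of_nat_nat) linarith+
    have "real (n ^ (2 * m)) = 2 powr (2 * real m * log 2 (real n))"
      using assms by (simp add: powr_realpow[symmetric] powr_def log_def)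
    also have "\<dots> < 2 powr real N" using N(1) by simp
    also have "\<dots> = real (2 ^ N)" by (simp add: powr_realpow)
    finally have "n ^ (2 * m) < 2 ^ N" by linarith
    then have "dm_dim (multiset_layers n k l) \<le> 8 * m * N"
      using m by (intro dm_dim_multiset_layers_le_colourings)
    then have "real (dm_dim (multiset_layers n k l)) \<le> 8 * real m * real N"
      by (metis of_nat_le_iff of_nat_mult of_nat_numeral)
    also have "\<dots> \<le> 8 * real m * (2 * real m * log 2 (real n) + 1)"
      using N(2) by (intro mult_left_mono) auto
    also have "log 2 (real n) \<le> 3 / 2 * L"
    proof -
      have "L * 1 \<le> L * (3 / 2 * ln 2)" using ln2_ge_two_thirds L by (intro mult_left_mono) auto
      then show ?thesis by (simp add: log_def L_def field_simps)
    qed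
    \<comment> \<open>The main term is \<open>24 * m^2 * L\<close>. The remainder
      \<open>8 * m\<close>, due to rounding \<open>N\<close> up, fits into
      \<open>10 * m^2 * L\<close> because \<open>m * L\<close> is at least 4/3 for
      \<open>n = 2\<close> and at least 1 for \<open>n \<ge> 3\<close>.\<close>
    also have "8 * real m * (2 * real m * (3 / 2 * L) + 1) \<le> 34 * (real m)\<^sup>2 * L"
    proof -
      have "8 \<le> 10 * (real m * L)"
      proof (cases "n = 2")
        case True
        with False m(1) have "real m \<ge> 2" by linarith
        then have "2 * (2 / 3) \<le> real m * L" using L by (intro mult_mono) auto
        then show ?thesis by linarith
      next
        case False
        with assms have "exp 1 \<le> real n" using exp_le by linarith
        then have "L \<ge> 1" unfolding L_def using assms by (simp add: ln_ge_iff)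
        then have "1 * 1 \<le> real m * L" using m(1) by (intro mult_mono) auto
        then show ?thesis by linarith
      qed
      then have "real m * 8 \<le> real m * (10 * (real m * L))" by (rule mult_left_mono) simp
      then show ?thesis by (simp add: power2_eq_square algebra_simps)
    qed
    finally show ?thesis using m(3) by (simp add: L_def mult_left_mono)
  qed
qed

end
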